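(* There is a randomized algorithm with worst-case running time $O(\Delta^4 \log^2 \Delta / \epsilon^2)$ which, given $\epsilon>0$ and a graph $G$ with $n$ vertices, $m \geq n$ edges and maximum degree $\Delta$, returns a number $H$ satisfying, with high probability, $$OPT(G) \leq H \leq OPT(G) + (1+\epsilon).$$
   Context: Minimum entropy orientation problem: given an undirected graph $G=(V,E)$ with $m=|E|$, an orientation of $G$ has entropy $-\sum_{v\in V} p_v\log p_v$ where $p_v := \rho(v)/m$ and $\rho(v)$ is the indegree of $v$ in the orientation; logarithms are base 2 and $0\log 0 := 0$. $OPT(G)$ denotes the minimum entropy of an orientation of $G$. The algorithm accesses $G$ through local queries: it may sample a vertex uniformly at random and query the degree and the neighbors of a vertex (adjacency-list access), each query at unit cost, so that its running time does not depend on $n$. *)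

theory Defs
  imports "HOL-Probability.Probability"
begin

section \<open>Graphs and minimum entropy orientations\<close>

text \<open>Vertices are named by natural numbers, but the set of names is an arbitrary finite set.\<close>

definition simple_graph :: "nat set \<Rightarrow> nat set set \<Rightarrow> bool" where
  "simple_graph V E \<longleftrightarrow> finite V \<and> (\<forall>e\<in>E. e \<subseteq> V \<and> card e = 2)"

definition vdegree :: "nat set set \<Rightarrow> nat \<Rightarrow> nat" where
  "vdegree E v = card {e \<in> E. v \<in> e}"

definition max_degree :: "nat set \<Rightarrow> nat set set \<Rightarrow> nat" where
  "max_degree V E = Max (vdegree E ` V)"

text \<open>An orientation is given by the head of every edge.\<close>

definition orientations :: "nat set set \<Rightarrow> (nat set \<Rightarrow> nat) set" where
  "orientations E = (\<Pi>\<^sub>E e\<in>E. e)"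

definition indegree :: "nat set set \<Rightarrow> (nat set \<Rightarrow> nat) \<Rightarrow> nat \<Rightarrow> nat" where
  "indegree E h v = card {e \<in> E. h e = v}"

text \<open>The convention \<open>0 log 0 = 0\<close> holds automatically, the logarithm being total.\<close>

definition orientation_entropy :: "nat set \<Rightarrow> nat set set \<Rightarrow> (nat set \<Rightarrow> nat) \<Rightarrow> real" where
  "orientation_entropy V E h =
     - (\<Sum>v\<in>V. let p = real (indegree E h v) / real (card E) in p * log 2 p)"

definition OPT :: "nat set \<Rightarrow> nat set set \<Rightarrow> real" where
  "OPT V E = Min (orientation_entropy V E ` orientations E)"


section \<open>Randomized algorithms with local access to a graph\<close>

text \<open>
  Algorithms are while programs over finitely many registers holding real numbers (vertex names
  and indices are stored as reals). Every arithmetic operation, binary logarithm, comparison,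
  Boolean connective, assignment, branch and query costs one time unit. Literals are natural
  numbers, so a program cannot contain uncomputable constants.
\<close>

type_synonym vname = string
type_synonym store = "vname \<Rightarrow> real"

datatype aexp =
    Lit nat | Reg vname
  | Plus aexp aexp | Minus aexp aexp | Times aexp aexp | Divide aexp aexp | Log2 aexp

datatype bexp = Less aexp aexp | Neg bexp | Conj bexp bexp

datatype com =
    Skip
  | Assign vname aexp
  | Sample vname
  | Degree vname aexp
  | Neighbor vname aexp aexp
  | Seq com com
  | Cond bexp com com
  | While bexp com

fun aval :: "aexp \<Rightarrow> store \<Rightarrow> real" where
  "aval (Lit n) s = real n"
| "aval (Reg x) s = s x"
| "aval (Plus a b) s = aval a s + aval b s"
| "aval (Minus a b) s = aval a s - aval b s"
| "aval (Times a b) s = aval a s * aval b s"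
| "aval (Divide a b) s = aval a s / aval b s"
| "aval (Log2 a) s = log 2 (aval a s)"

fun bval :: "bexp \<Rightarrow> store \<Rightarrow> bool" where
  "bval (Less a b) s \<longleftrightarrow> aval a s < aval b s"
| "bval (Neg b) s \<longleftrightarrow> \<not> bval b s"
| "bval (Conj b c) s \<longleftrightarrow> bval b s \<and> bval c s"

fun aops :: "aexp \<Rightarrow> nat" where
  "aops (Lit n) = 0"
| "aops (Reg x) = 0"
| "aops (Plus a b) = aops a + aops b + 1"
| "aops (Minus a b) = aops a + aops b + 1"
| "aops (Times a b) = aops a + aops b + 1"
| "aops (Divide a b) = aops a + aops b + 1"
| "aops (Log2 a) = aops a + 1"

fun bops :: "bexp \<Rightarrow> nat" where
  "bops (Less a b) = aops a + aops b + 1"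
| "bops (Neg b) = bops b + 1"
| "bops (Conj b c) = bops b + bops c + 1"

text \<open>
  The input graph is accessible only through its adjacency lists, whose order is arbitrary. They
  are unconstrained outside of \<open>V\<close>, so nothing can be learnt by querying a non-vertex.
\<close>

definition adjacency_lists :: "nat set \<Rightarrow> nat set set \<Rightarrow> (nat \<Rightarrow> nat list) \<Rightarrow> bool" where
  "adjacency_lists V E adj \<longleftrightarrow>
     (\<forall>v\<in>V. distinct (adj v) \<and> set (adj v) = {u. {u, v} \<in> E})"

text \<open>
  The random vertices returned by the successive sampling queries are given in advance, as an
  infinite sequence \<open>\<omega>\<close>; a machine state is a store together with the number of samples
  drawn so far. \<open>exec adj \<omega> c \<sigma> k \<tau>\<close> means that \<open>c\<close> started in \<open>\<sigma>\<close> terminates in \<open>\<tau>\<close> after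
  \<open>k\<close> time units. Queries whose argument is not a natural number, or that ask for a neighbor
  of too large an index, have no execution. Neighbors are indexed from 0.
\<close>

inductive exec ::
  "(nat \<Rightarrow> nat list) \<Rightarrow> (nat \<Rightarrow> nat) \<Rightarrow> com \<Rightarrow> store \<times> nat \<Rightarrow> nat \<Rightarrow> store \<times> nat \<Rightarrow> bool"
  for adj :: "nat \<Rightarrow> nat list" and \<omega> :: "nat \<Rightarrow> nat"
where
  Skip: "exec adj \<omega> Skip \<sigma> 1 \<sigma>"
| Assign: "exec adj \<omega> (Assign x a) (s, i) (aops a + 1) (s(x := aval a s), i)"
| Sample: "exec adj \<omega> (Sample x) (s, i) 1 (s(x := real (\<omega> i)), Suc i)"
| Degree: "aval a s = real v \<Longrightarrow>
    exec adj \<omega> (Degree x a) (s, i) (aops a + 1) (s(x := real (length (adj v))), i)"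
| Neighbor: "\<lbrakk>aval a s = real v; aval b s = real j; j < length (adj v)\<rbrakk> \<Longrightarrow>
    exec adj \<omega> (Neighbor x a b) (s, i) (aops a + aops b + 1) (s(x := real (adj v ! j)), i)"
| Seq: "\<lbrakk>exec adj \<omega> c \<sigma> k \<sigma>'; exec adj \<omega> d \<sigma>' l \<tau>\<rbrakk> \<Longrightarrow> exec adj \<omega> (Seq c d) \<sigma> (k + l) \<tau>"
| CondTrue: "\<lbrakk>bval b (fst \<sigma>); exec adj \<omega> c \<sigma> k \<tau>\<rbrakk> \<Longrightarrow>
    exec adj \<omega> (Cond b c d) \<sigma> (bops b + 1 + k) \<tau>"
| CondFalse: "\<lbrakk>\<not> bval b (fst \<sigma>); exec adj \<omega> d \<sigma> k \<tau>\<rbrakk> \<Longrightarrow>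
    exec adj \<omega> (Cond b c d) \<sigma> (bops b + 1 + k) \<tau>"
| WhileFalse: "\<not> bval b (fst \<sigma>) \<Longrightarrow> exec adj \<omega> (While b c) \<sigma> (bops b + 1) \<sigma>"
| WhileTrue: "\<lbrakk>bval b (fst \<sigma>); exec adj \<omega> c \<sigma> k \<sigma>'; exec adj \<omega> (While b c) \<sigma>' l \<tau>\<rbrakk> \<Longrightarrow>
    exec adj \<omega> (While b c) \<sigma> (bops b + 1 + k + l) \<tau>"

inductive_cases SkipE: "exec adj \<omega> Skip \<sigma> k \<tau>"
inductive_cases AssignE: "exec adj \<omega> (Assign x a) \<sigma> k \<tau>"
inductive_cases SampleE: "exec adj \<omega> (Sample x) \<sigma> k \<tau>"
inductive_cases DegreeE: "exec adj \<omega> (Degree x a) \<sigma> k \<tau>"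
inductive_cases NeighborE: "exec adj \<omega> (Neighbor x a b) \<sigma> k \<tau>"
inductive_cases SeqE: "exec adj \<omega> (Seq c d) \<sigma> k \<tau>"
inductive_cases CondE: "exec adj \<omega> (Cond b c d) \<sigma> k \<tau>"
inductive_cases WhileE: "exec adj \<omega> (While b c) \<sigma> k \<tau>"

lemma exec_deterministic:
  "exec adj \<omega> c \<sigma> k \<tau> \<Longrightarrow> exec adj \<omega> c \<sigma> k' \<tau>' \<Longrightarrow> k' = k \<and> \<tau>' = \<tau>"
proof (induction arbitrary: k' \<tau>' rule: exec.induct)
  case Skip then show ?case by (auto elim: SkipE)
next
  case Assign then show ?case by (auto elim: AssignE)
next
  case Sample then show ?case by (auto elim: SampleE)
next
  case Degree then show ?case by (auto elim!: DegreeE)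
next
  case Neighbor then show ?case by (auto elim!: NeighborE)
next
  case Seq from Seq.prems show ?case by (rule SeqE) (use Seq.IH in blast)
next
  case (CondTrue b \<sigma> c k \<tau> d)
  from CondTrue.prems CondTrue.hyps(1) obtain k2 where
    "k' = bops b + 1 + k2" "exec adj \<omega> c \<sigma> k2 \<tau>'" by (auto elim: CondE)
  with CondTrue.IH show ?case by simp
next
  case (CondFalse b \<sigma> d k \<tau> c)
  from CondFalse.prems CondFalse.hyps(1) obtain k2 where
    "k' = bops b + 1 + k2" "exec adj \<omega> d \<sigma> k2 \<tau>'" by (auto elim: CondE)
  with CondFalse.IH show ?case by simp
next
  case (WhileFalse b \<sigma> c)
  then show ?case by (auto elim: WhileE)
next
  case (WhileTrue b \<sigma> c k \<sigma>' l \<tau>)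
  from WhileTrue.prems WhileTrue.hyps(1) obtain k2 \<rho> l2 where
    e: "k' = bops b + 1 + k2 + l2" "exec adj \<omega> c \<sigma> k2 \<rho>" "exec adj \<omega> (While b c) \<rho> l2 \<tau>'"
    by (auto elim: WhileE)
  from WhileTrue.IH(1)[OF e(2)] have "k2 = k" "\<rho> = \<sigma>'" by auto
  with WhileTrue.IH(2) e show ?case by auto
qed

definition init_store :: "nat \<Rightarrow> nat \<Rightarrow> nat \<Rightarrow> real \<Rightarrow> store" where
  "init_store n m \<Delta> \<epsilon> =
     (\<lambda>_. 0)(''n'' := real n, ''m'' := real m, ''Delta'' := real \<Delta>, ''eps'' := \<epsilon>)"

text \<open>
  \<open>returns adj \<omega> P n m \<Delta> \<epsilon> k H\<close>: on the given input and sequence of samples, \<open>P\<close> returns \<open>H\<close>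
  after \<open>k\<close> time units.
\<close>

definition returns ::
  "(nat \<Rightarrow> nat list) \<Rightarrow> (nat \<Rightarrow> nat) \<Rightarrow> com \<Rightarrow> nat \<Rightarrow> nat \<Rightarrow> nat \<Rightarrow> real \<Rightarrow> nat \<Rightarrow> real \<Rightarrow> bool"
where
  "returns adj \<omega> P n m \<Delta> \<epsilon> k H \<longleftrightarrow>
     (\<exists>t i. exec adj \<omega> P (init_store n m \<Delta> \<epsilon>, 0) k (t, i) \<and> t ''H'' = H)"

text \<open>Sequences of independent uniformly random vertices.\<close>

definition samples :: "nat set \<Rightarrow> (nat \<Rightarrow> nat) measure" where
  "samples V = (\<Pi>\<^sub>M i\<in>UNIV. uniform_count_measure V)"

end

theory Submission
  imports Defs
begin

text \<open>
  Orient every edge towards an endpoint of maximum degree. Comparing indegrees with degrees shows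
  that \<open>Z = log (2 m) - (1/m) \<Sum>\<^sub>u\<^sub>v log (max (deg u) (deg v))\<close> is at most one more than the entropy
  of any orientation, while Gibbs' inequality against the distribution \<open>deg v / (2 m)\<close> shows
  that \<open>Z\<close> is at least the entropy of the biased orientation. So \<open>OPT \<le> Z \<le> OPT + 1\<close>, and it
  remains to estimate \<open>Z\<close> within \<open>\<epsilon>/2\<close>. The mean over the edges is the expectation over a random vertex
  \<open>v\<close> of \<open>n/(2 m)\<close> times the sum over the edges at \<open>v\<close>, a quantity in \<open>[0, \<Delta> log \<Delta> / 2]\<close> because
  \<open>m \<ge> n\<close>; by Hoeffding's inequality \<open>O((\<Delta> log \<Delta> / \<epsilon>)\<^sup>2)\<close> samples suffice, each at cost \<open>O(\<Delta>)\<close>.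
\<close>

section \<open>Degree sums\<close>

locale local_access_graph =
  fixes V :: "nat set" and E :: "nat set set" and adj :: "nat \<Rightarrow> nat list"
  assumes graph: "simple_graph V E"
    and adj: "adjacency_lists V E adj"
    and edges_nonempty: "E \<noteq> {}"
begin

lemma finite_vertices: "finite V"
  using graph by (simp add: simple_graph_def)

lemma edge_subset: "e \<in> E \<Longrightarrow> e \<subseteq> V"
  and card_edge: "e \<in> E \<Longrightarrow> card e = 2"
  using graph by (auto simp: simple_graph_def)

lemma finite_edge: "e \<in> E \<Longrightarrow> finite e"
  and edge_not_empty: "e \<in> E \<Longrightarrow> e \<noteq> {}"
  using card_edge[of e] by (auto intro: card_ge_0_finite)

lemma finite_edges: "finite E"
  using finite_vertices edge_subset by (meson PowI finite_Pow_iff finite_subset subsetI)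

lemma card_edges_pos: "card E > 0"
  using finite_edges edges_nonempty by (simp add: card_gt_0_iff)

lemma adj_vertices: "v \<in> V \<Longrightarrow> u \<in> set (adj v) \<Longrightarrow> u \<in> V"
  using adj edge_subset by (fastforce simp: adjacency_lists_def)

text \<open>Edges have two distinct endpoints, so mapping \<open>u\<close> to \<open>{u, v}\<close>
  is a bijection from the neighbors of \<open>v\<close> onto its incident edges. This turns what a
  program can see into sums over edges.\<close>

lemma sum_list_adj:
  fixes f :: "nat set \<Rightarrow> real"
  assumes "v \<in> V"
  shows "(\<Sum>u\<leftarrow>adj v. f {u, v}) = (\<Sum>e\<in>{e \<in> E. v \<in> e}. f e)"
proof -
  have d: "distinct (adj v)" and s: "set (adj v) = {u. {u, v} \<in> E}"
    using adj assms by (auto simp: adjacency_lists_def)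
  have "bij_betw (\<lambda>u. {u, v}) {u. {u, v} \<in> E} {e \<in> E. v \<in> e}"
  proof (rule bij_betw_imageI)
    show "inj_on (\<lambda>u. {u, v}) {u. {u, v} \<in> E}"
      by (auto simp: inj_on_def doubleton_eq_iff)
    have "\<exists>u. e = {u, v}" if "e \<in> E" "v \<in> e" for e
      using card_edge[OF that(1)] that(2) by (auto simp: card_2_iff)
    then show "(\<lambda>u. {u, v}) ` {u. {u, v} \<in> E} = {e \<in> E. v \<in> e}"
      by (auto simp: image_iff)
  qed
  then have "(\<Sum>u\<in>set (adj v). f {u, v}) = (\<Sum>e\<in>{e \<in> E. v \<in> e}. f e)"
    unfolding s by (rule sum.reindex_bij_betw)
  then show ?thesis
    by (simp add: sum_list_distinct_conv_sum_set d)
qed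

lemma length_adj: "v \<in> V \<Longrightarrow> length (adj v) = vdegree E v"
  using sum_list_adj[of v "\<lambda>_. 1"] by (simp add: vdegree_def sum_list_triv)

text \<open>Double counting: every edge is met from both endpoints. The constant 1 gives the
  handshake lemma, \<open>weight\<close> the total of the local sums.\<close>

lemma sum_incident_edges:
  fixes f :: "nat set \<Rightarrow> real"
  shows "(\<Sum>v\<in>V. \<Sum>e\<in>{e \<in> E. v \<in> e}. f e) = 2 * (\<Sum>e\<in>E. f e)"
proof -
  have "(\<Sum>v\<in>V. \<Sum>e\<in>{e \<in> E. v \<in> e}. f e) = (\<Sum>e\<in>E. \<Sum>v\<in>{v \<in> V. v \<in> e}. f e)"
    by (rule sum.swap_restrict) (fact finite_vertices finite_edges)+
  also have "\<dots> = (\<Sum>e\<in>E. 2 * f e)"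
  proof (rule sum.cong)
    fix e assume e: "e \<in> E"
    then have "{v \<in> V. v \<in> e} = e"
      using edge_subset by auto
    then show "(\<Sum>v\<in>{v \<in> V. v \<in> e}. f e) = 2 * f e"
      using card_edge[OF e] by simp
  qed simp
  finally show ?thesis
    by (simp add: sum_distrib_left)
qed

lemma sum_vdegree: "(\<Sum>v\<in>V. real (vdegree E v)) = 2 * real (card E)"
  using sum_incident_edges[of "\<lambda>_. 1"] by (simp add: vdegree_def)

lemma vdegree_pos: "e \<in> E \<Longrightarrow> v \<in> e \<Longrightarrow> vdegree E v > 0"
  using finite_edges by (auto simp: vdegree_def card_gt_0_iff)

lemma vdegree_le_max_degree: "v \<in> V \<Longrightarrow> vdegree E v \<le> max_degree V E"
  using finite_vertices by (auto simp: max_degree_def)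

text \<open>The average degree 2 m / n is at least 2, and the maximum is no smaller.\<close>

lemma max_degree_ge_2:
  assumes "card V \<le> card E"
  shows "max_degree V E \<ge> 2"
proof -
  have "V \<noteq> {}"
    using edges_nonempty edge_subset edge_not_empty by blast
  then have n: "card V > 0"
    using finite_vertices by (simp add: card_gt_0_iff)
  have "2 * real (card V) \<le> (\<Sum>v\<in>V. real (vdegree E v))"
    using assms by (simp add: sum_vdegree)
  also have "\<dots> \<le> (\<Sum>v\<in>V. real (max_degree V E))"
    by (intro sum_mono) (simp add: vdegree_le_max_degree)
  finally have "real (card V) * 2 \<le> real (card V) * real (max_degree V E)"
    by (simp add: mult.commute)
  then show ?thesis
    using n by simp
qed


section \<open>Sandwiching the optimum\<close>

definition weight :: "nat set \<Rightarrow> real" where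
  "weight e = log 2 (real (Max (vdegree E ` e)))"

text \<open>The number Z of the introduction is
  \<open>log 2 (2 * real (card E)) - mean_weight\<close>.\<close>

definition mean_weight :: real where
  "mean_weight = (\<Sum>e\<in>E. weight e) / real (card E)"

lemma Max_vdegree_bounds:
  assumes "e \<in> E"
  shows "1 \<le> Max (vdegree E ` e)" "Max (vdegree E ` e) \<le> max_degree V E"
proof -
  have "Max (vdegree E ` e) \<in> vdegree E ` e"
    using finite_edge[OF assms] edge_not_empty[OF assms] by (intro Max_in) auto
  then obtain v where "v \<in> e" "Max (vdegree E ` e) = vdegree E v"
    by auto
  then show "1 \<le> Max (vdegree E ` e)" "Max (vdegree E ` e) \<le> max_degree V E"
    using vdegree_pos[OF assms] vdegree_le_max_degree edge_subset[OF assms] by (auto simp: Suc_le_eq)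
qed

lemma weight_nonneg: "e \<in> E \<Longrightarrow> 0 \<le> weight e"
  using Max_vdegree_bounds(1) by (force simp: weight_def)

lemma weight_le: "e \<in> E \<Longrightarrow> weight e \<le> log 2 (real (max_degree V E))"
  using Max_vdegree_bounds[of e] by (simp add: weight_def)

lemma mean_weight_nonneg: "0 \<le> mean_weight"
  unfolding mean_weight_def by (intro divide_nonneg_nonneg sum_nonneg weight_nonneg) auto

lemma mean_weight_le: "mean_weight \<le> log 2 (real (max_degree V E))"
proof -
  have "(\<Sum>e\<in>E. weight e) \<le> (\<Sum>e\<in>E. log 2 (real (max_degree V E)))"
    by (intro sum_mono weight_le)
  then show ?thesis
    using card_edges_pos by (simp add: mean_weight_def field_simps)
qed

lemma orientation_head: "h \<in> orientations E \<Longrightarrow> e \<in> E \<Longrightarrow> h e \<in> e"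
  by (auto simp: orientations_def)

lemma indegree_pos: "e \<in> E \<Longrightarrow> indegree E h (h e) > 0"
  using finite_edges by (auto simp: indegree_def card_gt_0_iff)

lemma sum_over_heads:
  fixes f :: "nat \<Rightarrow> real"
  assumes "h \<in> orientations E"
  shows "(\<Sum>e\<in>E. f (h e)) = (\<Sum>v\<in>V. real (indegree E h v) * f v)"
proof -
  have "h ` E \<subseteq> V"
    using orientation_head[OF assms] edge_subset by auto
  then have "(\<Sum>e\<in>E. f (h e)) = (\<Sum>v\<in>V. \<Sum>e\<in>{e. e \<in> E \<and> h e = v}. f (h e))"
    by (intro sum.group[symmetric] finite_vertices finite_edges)
  also have "\<dots> = (\<Sum>v\<in>V. real (indegree E h v) * f v)"
    by (intro sum.cong refl) (simp add: indegree_def)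
  finally show ?thesis .
qed

text \<open>Grouping edges by their heads makes the entropy an average over edges, which can be
  compared with \<open>weight\<close> edge by edge.\<close>

lemma orientation_entropy_eq:
  assumes "h \<in> orientations E"
  shows "orientation_entropy V E h =
    (\<Sum>e\<in>E. - log 2 (real (indegree E h (h e)) / real (card E))) / real (card E)"
  unfolding orientation_entropy_def Let_def
    sum_over_heads[OF assms, of "\<lambda>v. - log 2 (real (indegree E h v) / real (card E))"]
  by (simp add: sum_divide_distrib sum_negf)

text \<open>The indegree of a head is at most its degree, hence at most the larger endpoint degree;
  this compares the two averages termwise. The 1 is the logarithm of the factor 2 in
  \<open>2 * real (card E)\<close>.\<close>

lemma orientation_entropy_ge:
  assumes h: "h \<in> orientations E"
  shows "log 2 (2 * real (card E)) - mean_weight \<le> orientation_entropy V E h + 1"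
proof -
  have "log 2 (real (card E)) - weight e \<le> - log 2 (real (indegree E h (h e)) / real (card E))"
    if e: "e \<in> E" for e
  proof -
    have "indegree E h (h e) \<le> vdegree E (h e)"
      unfolding indegree_def vdegree_def using finite_edges orientation_head[OF h]
      by (intro card_mono) (auto, metis)
    also have "\<dots> \<le> Max (vdegree E ` e)"
      using finite_edge[OF e] orientation_head[OF h e] by simp
    finally have "log 2 (real (indegree E h (h e))) \<le> weight e"
      using indegree_pos[OF e, of h] by (simp add: weight_def)
    then show ?thesis
      using indegree_pos[OF e, of h] card_edges_pos by (simp add: log_divide)
  qed
  then have "(\<Sum>e\<in>E. log 2 (real (card E)) - weight e) / real (card E) \<le> orientation_entropy V E h"
    unfolding orientation_entropy_eq[OF h] by (intro divide_right_mono sum_mono) auto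
  moreover have "(\<Sum>e\<in>E. log 2 (real (card E)) - weight e) / real (card E)
      = log 2 (real (card E)) - mean_weight"
    using card_edges_pos by (simp add: sum_subtractf mean_weight_def field_simps)
  ultimately show ?thesis
    using card_edges_pos by (simp add: log_mult)
qed

text \<open>
  For the orientation towards endpoints of maximum degree, the claim is that
  \<open>\<Sum>e\<in>E. log 2 (2 \<rho> / d) \<ge> 0\<close>, where \<open>\<rho>\<close> and \<open>d\<close> are the indegree and the degree of the head of
  \<open>e\<close>. It follows from \<open>ln x \<ge> 1 - 1 / x\<close> and the handshake lemma.
\<close>

lemma biased_orientation:
  obtains h where "h \<in> orientations E"
    "orientation_entropy V E h \<le> log 2 (2 * real (card E)) - mean_weight"
proof -
  have "\<exists>v\<in>e. vdegree E v = Max (vdegree E ` e)" if "e \<in> E" for e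
  proof -
    have "Max (vdegree E ` e) \<in> vdegree E ` e"
      using finite_edge[OF that] edge_not_empty[OF that] by (intro Max_in) auto
    then show ?thesis
      by auto
  qed
  then obtain b where b: "\<And>e. e \<in> E \<Longrightarrow> b e \<in> e"
      "\<And>e. e \<in> E \<Longrightarrow> vdegree E (b e) = Max (vdegree E ` e)"
    by metis
  define h where "h = restrict b E"
  have h: "h \<in> orientations E"
    using b by (auto simp: h_def orientations_def)
  have hd: "vdegree E (h e) = Max (vdegree E ` e)" if "e \<in> E" for e
    using b that by (simp add: h_def)
  let ?r = "\<lambda>v. real (indegree E h v)" and ?d = "\<lambda>v. real (vdegree E v)" and ?m = "real (card E)"
  have "(\<Sum>e\<in>E. ?d (h e) / (2 * ?r (h e))) = (\<Sum>v\<in>V. ?r v * (?d v / (2 * ?r v)))"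
    by (rule sum_over_heads[OF h])
  \<comment> \<open>Only an inequality: at a vertex of indegree 0 the left summand is 0, the right
    one half its degree.\<close>
  also have "\<dots> \<le> (\<Sum>v\<in>V. ?d v / 2)"
    by (intro sum_mono) simp
  also have "\<dots> = ?m"
    using sum_vdegree by (simp flip: sum_divide_distrib)
  finally have "0 \<le> (\<Sum>e\<in>E. 1 - ?d (h e) / (2 * ?r (h e)))"
    by (simp add: sum_subtractf)
  also have "\<dots> \<le> (\<Sum>e\<in>E. ln (2 * ?r (h e) / ?d (h e)))"
  proof (intro sum_mono)
    fix e assume e: "e \<in> E"
    have pos: "?r (h e) > 0" "?d (h e) > 0"
      using indegree_pos[OF e, of h] vdegree_pos[OF e orientation_head[OF h e]] by auto
    then have "ln (?d (h e) / (2 * ?r (h e))) \<le> ?d (h e) / (2 * ?r (h e)) - 1"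
      by (intro ln_le_minus_one) simp
    then show "1 - ?d (h e) / (2 * ?r (h e)) \<le> ln (2 * ?r (h e) / ?d (h e))"
      using pos by (simp add: ln_div)
  qed
  \<comment> \<open>The head has the larger degree on its edge, so \<open>weight e\<close> is the
    logarithm of that degree, and \<open>?m\<close> cancels.\<close>
  also have "\<dots> = ln 2 * (\<Sum>e\<in>E. log 2 (2 * ?m) - weight e + log 2 (?r (h e) / ?m))"
    unfolding sum_distrib_left
  proof (intro sum.cong refl)
    fix e assume e: "e \<in> E"
    have "?r (h e) > 0" "?d (h e) > 0" "?m > 0"
      using indegree_pos[OF e, of h] vdegree_pos[OF e orientation_head[OF h e]] card_edges_pos by auto
    then show "ln (2 * ?r (h e) / ?d (h e))
        = ln 2 * (log 2 (2 * ?m) - weight e + log 2 (?r (h e) / ?m))"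
      unfolding weight_def hd[OF e, symmetric]
      by (simp add: log_def ln_div ln_mult field_simps)
  qed
  finally have "0 \<le> (\<Sum>e\<in>E. log 2 (2 * ?m) - weight e + log 2 (?r (h e) / ?m)) / ?m"
    by (simp add: zero_le_mult_iff)
  also have "\<dots> = log 2 (2 * ?m) - mean_weight - orientation_entropy V E h"
    using card_edges_pos unfolding orientation_entropy_eq[OF h] mean_weight_def
    by (simp add: sum.distrib sum_subtractf sum_negf field_simps)
  finally show ?thesis
    using that h by simp
qed

lemma finite_orientations: "finite (orientations E)"
  unfolding orientations_def by (intro finite_PiE finite_edges finite_edge)

lemma OPT_le: "OPT V E \<le> log 2 (2 * real (card E)) - mean_weight"
proof -
  obtain h where "h \<in> orientations E"
    "orientation_entropy V E h \<le> log 2 (2 * real (card E)) - mean_weight"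
    by (rule biased_orientation)
  then show ?thesis
    unfolding OPT_def using finite_orientations by (auto intro: Min.coboundedI order_trans)
qed

lemma OPT_ge: "log 2 (2 * real (card E)) - mean_weight \<le> OPT V E + 1"
proof -
  have "orientations E \<noteq> {}"
    using biased_orientation by blast
  then have "OPT V E \<in> orientation_entropy V E ` orientations E"
    unfolding OPT_def using finite_orientations by (intro Min_in) auto
  then show ?thesis
    using orientation_entropy_ge by auto
qed

end


section \<open>Estimating the mean weight by sampling vertices\<close>

text \<open>It refers to adjacency lists alone, so the output of the program can be described
  without a graph; on a graph it is the total weight of the edges at \<open>v\<close>.\<close>

definition local_sum :: "(nat \<Rightarrow> nat list) \<Rightarrow> nat \<Rightarrow> real" where
  "local_sum adj v = (\<Sum>u\<leftarrow>adj v. log 2 (real (max (length (adj v)) (length (adj u)))))"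

context local_access_graph
begin

lemma local_sum_eq:
  assumes "v \<in> V"
  shows "local_sum adj v = (\<Sum>e\<in>{e \<in> E. v \<in> e}. weight e)"
proof -
  have "local_sum adj v = (\<Sum>u\<leftarrow>adj v. weight {u, v})"
    unfolding local_sum_def weight_def
    by (intro arg_cong[where f = sum_list] map_cong refl)
      (use assms adj_vertices[OF assms] in \<open>simp add: length_adj max.commute\<close>)
  then show ?thesis
    using sum_list_adj[OF assms, of weight] by simp
qed

lemma local_sum_bounds:
  assumes v: "v \<in> V"
  shows "0 \<le> local_sum adj v"
    "local_sum adj v \<le> real (max_degree V E) * log 2 (real (max_degree V E))"
proof -
  show "0 \<le> local_sum adj v"
    unfolding local_sum_eq[OF v] by (intro sum_nonneg) (simp add: weight_nonneg)
  have "local_sum adj v \<le> (\<Sum>e\<in>{e \<in> E. v \<in> e}. log 2 (real (max_degree V E)))"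
    unfolding local_sum_eq[OF v] by (intro sum_mono) (simp add: weight_le)
  also have "\<dots> = real (vdegree E v) * log 2 (real (max_degree V E))"
    by (simp add: vdegree_def)
  also have "\<dots> \<le> real (max_degree V E) * log 2 (real (max_degree V E))"
  proof (rule mult_right_mono)
    \<comment> \<open>The sign follows because this logarithm bounds the nonnegative mean
      weight.\<close>
    show "0 \<le> log 2 (real (max_degree V E))"
      using mean_weight_nonneg mean_weight_le by linarith
  qed (simp add: vdegree_le_max_degree[OF v])
  finally show "local_sum adj v \<le> real (max_degree V E) * log 2 (real (max_degree V E))" .
qed

text \<open>Each edge contributes at both endpoints. Hence the local sum at a uniform vertex, scaled
  by n / (2 m), has the mean weight as its expectation.\<close>

lemma sum_local_sum: "(\<Sum>v\<in>V. local_sum adj v) = 2 * real (card E) * mean_weight"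
proof -
  have "(\<Sum>v\<in>V. local_sum adj v) = (\<Sum>v\<in>V. \<Sum>e\<in>{e \<in> E. v \<in> e}. weight e)"
    by (intro sum.cong) (simp_all add: local_sum_eq)
  then show ?thesis
    using card_edges_pos sum_incident_edges[of weight] by (simp add: mean_weight_def)
qed

end

section \<open>Independent uniform samples and Hoeffding's inequality\<close>

lemma prob_space_samples: "finite V \<Longrightarrow> V \<noteq> {} \<Longrightarrow> prob_space (samples V)"
  unfolding samples_def by (intro prob_space_PiM prob_space_uniform_count_measure)

lemma measurable_sample [measurable]: "(\<lambda>\<omega>. f (\<omega> t)) \<in> borel_measurable (samples V)"
proof -
  have "f \<in> borel_measurable (uniform_count_measure V)"
    by (auto simp: measurable_def sets_uniform_count_measure space_uniform_count_measure)
  then show ?thesis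
    unfolding samples_def by (intro measurable_compose[OF measurable_component_singleton[of t UNIV]]) simp_all
qed

lemma distr_sample:
  assumes "finite V" "V \<noteq> {}"
  shows "distr (samples V) (uniform_count_measure V) (\<lambda>\<omega>. \<omega> t) = uniform_count_measure V"
  unfolding samples_def
  by (intro distr_PiM_component prob_space_uniform_count_measure assms) simp

text \<open>Independence is checked on laws: the joint map of all coordinates is the identity on the
  product space, and each marginal is uniform.\<close>

lemma indep_samples:
  assumes "finite V" "V \<noteq> {}"
  shows "prob_space.indep_vars (samples V) (\<lambda>_. uniform_count_measure V) (\<lambda>t \<omega>. \<omega> t) UNIV"
proof -
  interpret prob_space "samples V"
    by (rule prob_space_samples[OF assms])
  have "random_variable (uniform_count_measure V) (\<lambda>\<omega>. \<omega> t)" for t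
    unfolding samples_def by (rule measurable_component_singleton) simp
  moreover have "distr (samples V) (\<Pi>\<^sub>M t\<in>UNIV. uniform_count_measure V) (\<lambda>\<omega>. \<lambda>t\<in>UNIV. \<omega> t)
      = (\<Pi>\<^sub>M t\<in>UNIV. distr (samples V) (uniform_count_measure V) (\<lambda>\<omega>. \<omega> t))"
    unfolding distr_sample[OF assms] by (simp add: samples_def restrict_def distr_id)
  ultimately show ?thesis
    by (subst indep_vars_iff_distr_eq_PiM) simp_all
qed

text \<open>Hoeffding's inequality for the independent variables \<open>f (\<omega> t)\<close>,
  which all share the law of \<open>f (\<omega> 0)\<close>; its expectation is the plain average of
  \<open>f\<close> over \<open>V\<close>.\<close>

lemma sampling_error:
  fixes f :: "nat \<Rightarrow> real"
  assumes V: "finite V" "V \<noteq> {}"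
    and f: "\<And>v. v \<in> V \<Longrightarrow> 0 \<le> f v" "\<And>v. v \<in> V \<Longrightarrow> f v \<le> b"
    and "b > 0" "N > 0" "\<epsilon> \<ge> 0"
  shows "\<P>(\<omega> in samples V. \<bar>(\<Sum>t<N. f (\<omega> t)) / real N - (\<Sum>v\<in>V. f v) / real (card V)\<bar> \<ge> \<epsilon>)
    \<le> 2 * exp (- 2 * real N * \<epsilon>\<^sup>2 / b\<^sup>2)"
proof -
  interpret prob_space "samples V"
    by (rule prob_space_samples[OF V])
  have f_meas: "f \<in> borel_measurable (uniform_count_measure V)"
    by (auto simp: measurable_def sets_uniform_count_measure space_uniform_count_measure)
  have comp: "(\<lambda>\<omega>. \<omega> t) \<in> measurable (samples V) (uniform_count_measure V)" for t
    unfolding samples_def by (rule measurable_component_singleton) simp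
  have distr: "distr (samples V) borel (\<lambda>\<omega>. f (\<omega> t)) = distr (uniform_count_measure V) borel f" for t
    using distr_distr[OF f_meas comp, of t] by (simp add: distr_sample[OF V] comp_def)
  interpret Hoeffding_ineq_iid "samples V" "{..<N}" "\<lambda>t \<omega>. f (\<omega> t)" "\<lambda>\<omega>. f (\<omega> 0)" 0 b
    "expectation (\<lambda>\<omega>. f (\<omega> 0))"
  proof unfold_locales
    have "indep_vars (\<lambda>_. borel) (\<lambda>t \<omega>. f (\<omega> t)) UNIV"
      by (rule indep_vars_compose2[OF indep_samples[OF V]]) (rule f_meas)
    then show "indep_vars (\<lambda>_. borel) (\<lambda>t \<omega>. f (\<omega> t)) {..<N}"
      by (rule indep_vars_subset) simp
    have "\<omega> 0 \<in> V" if "\<omega> \<in> space (samples V)" for \<omega>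
      using that by (auto simp: samples_def space_PiM space_uniform_count_measure)
    then show "AE \<omega> in samples V. f (\<omega> 0) \<in> {0..b}"
      using f by auto
  qed (simp_all add: distr)
  have mean: "expectation (\<lambda>\<omega>. f (\<omega> 0)) = integral\<^sup>L (uniform_count_measure V) f"
    using integral_distr[OF comp f_meas, of 0] by (simp add: distr_sample[OF V])
  have "{..<N} \<noteq> {}"
    using \<open>N > 0\<close> by (simp add: lessThan_empty_iff)
  from Hoeffding_ineq_abs_ge'[OF \<open>\<epsilon> \<ge> 0\<close> \<open>b > 0\<close> this] show ?thesis
    unfolding mean integral_uniform_count_measure[OF V(1)] card_lessThan diff_zero .
qed


section \<open>Total correctness with a cost bound\<close>

text \<open>A Hoare triple for total correctness with a time budget. \<open>K\<close> is only an
  upper bound, so branches of different cost can share it.\<close>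

definition runs ::
  "(nat \<Rightarrow> nat list) \<Rightarrow> (nat \<Rightarrow> nat) \<Rightarrow> com \<Rightarrow> store \<times> nat \<Rightarrow> nat \<Rightarrow> (store \<times> nat \<Rightarrow> bool) \<Rightarrow> bool"
where
  "runs adj \<omega> c \<sigma> K Q \<longleftrightarrow> (\<exists>k \<tau>. exec adj \<omega> c \<sigma> k \<tau> \<and> k \<le> K \<and> Q \<tau>)"

lemma runs_mono:
  "runs adj \<omega> c \<sigma> K Q \<Longrightarrow> K \<le> L \<Longrightarrow> (\<And>\<tau>. Q \<tau> \<Longrightarrow> R \<tau>) \<Longrightarrow> runs adj \<omega> c \<sigma> L R"
  unfolding runs_def by (meson order_trans)

lemma runs_le: "runs adj \<omega> c \<sigma> K Q \<Longrightarrow> K \<le> L \<Longrightarrow> runs adj \<omega> c \<sigma> L Q"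
  by (rule runs_mono)

lemma runs_Skip: "Q \<sigma> \<Longrightarrow> runs adj \<omega> Skip \<sigma> 1 Q"
  unfolding runs_def using exec.Skip by blast

lemma runs_Assign: "Q (s(x := aval a s), i) \<Longrightarrow> runs adj \<omega> (Assign x a) (s, i) (aops a + 1) Q"
  unfolding runs_def using exec.Assign by blast

lemma runs_Sample: "Q (s(x := real (\<omega> i)), Suc i) \<Longrightarrow> runs adj \<omega> (Sample x) (s, i) 1 Q"
  unfolding runs_def using exec.Sample by blast

lemma runs_Degree:
  "aval a s = real v \<Longrightarrow> Q (s(x := real (length (adj v))), i)
    \<Longrightarrow> runs adj \<omega> (Degree x a) (s, i) (aops a + 1) Q"
  unfolding runs_def using exec.Degree by blast

lemma runs_Neighbor:
  "aval a s = real v \<Longrightarrow> aval b s = real j \<Longrightarrow> j < length (adj v)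
    \<Longrightarrow> Q (s(x := real (adj v ! j)), i)
    \<Longrightarrow> runs adj \<omega> (Neighbor x a b) (s, i) (aops a + aops b + 1) Q"
  unfolding runs_def using exec.Neighbor by blast

text \<open>The triple of the second command is the postcondition of the first, so that applying the
  rules in turn follows the execution forwards.\<close>

lemma runs_Seq:
  "runs adj \<omega> c \<sigma> K (\<lambda>\<tau>. runs adj \<omega> d \<tau> L Q) \<Longrightarrow> runs adj \<omega> (Seq c d) \<sigma> (K + L) Q"
  unfolding runs_def using exec.Seq add_mono by blast

lemma runs_Cond:
  assumes "bval b (fst \<sigma>) \<Longrightarrow> runs adj \<omega> c \<sigma> K Q" "\<not> bval b (fst \<sigma>) \<Longrightarrow> runs adj \<omega> d \<sigma> L Q"
  shows "runs adj \<omega> (Cond b c d) \<sigma> (bops b + 1 + max K L) Q"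
proof (cases "bval b (fst \<sigma>)")
  case True
  with assms(1) obtain k \<tau> where "exec adj \<omega> c \<sigma> k \<tau>" "k \<le> K" "Q \<tau>"
    unfolding runs_def by blast
  with True show ?thesis
    unfolding runs_def by (intro exI[of _ "bops b + 1 + k"] exI[of _ \<tau>]) (auto intro: exec.CondTrue[simplified])
next
  case False
  with assms(2) obtain k \<tau> where "exec adj \<omega> d \<sigma> k \<tau>" "k \<le> L" "Q \<tau>"
    unfolding runs_def by blast
  with False show ?thesis
    unfolding runs_def by (intro exI[of _ "bops b + 1 + k"] exI[of _ \<tau>]) (auto intro: exec.CondFalse[simplified])
qed

text \<open>The invariant is indexed by the number of iterations done, in total exactly
  \<open>N\<close>; the guard is paid for \<open>N + 1\<close> times.\<close>

lemma runs_While: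
  assumes step: "\<And>t \<sigma>. t < N \<Longrightarrow> I t \<sigma> \<Longrightarrow> bval b (fst \<sigma>) \<and> runs adj \<omega> c \<sigma> K (I (Suc t))"
    and exit: "\<And>\<sigma>. I N \<sigma> \<Longrightarrow> \<not> bval b (fst \<sigma>)"
    and init: "I 0 \<sigma>"
  shows "runs adj \<omega> (While b c) \<sigma> (N * (bops b + 1 + K) + bops b + 1) (I N)"
proof -
  have "runs adj \<omega> (While b c) \<sigma> ((N - t) * (bops b + 1 + K) + bops b + 1) (I N)"
    if "t \<le> N" "I t \<sigma>" for t \<sigma>
    using that
  \<comment> \<open>Downward from \<open>N\<close>, as the budget depends on the iterations still to
    come.\<close>
  proof (induction t arbitrary: \<sigma> rule: inc_induct)
    case base
    then show ?case
      unfolding runs_def using exec.WhileFalse[OF exit[OF base(1)], of adj \<omega> c]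
      by (intro exI[of _ "bops b + 1"] exI[of _ \<sigma>]) simp
  next
    case (step t)
    then obtain k \<sigma>' where 1: "bval b (fst \<sigma>)" "exec adj \<omega> c \<sigma> k \<sigma>'" "k \<le> K" "I (Suc t) \<sigma>'"
      using assms(1) unfolding runs_def by blast
    from step.IH[OF this(4)] obtain l \<tau> where 2: "exec adj \<omega> (While b c) \<sigma>' l \<tau>"
      "l \<le> (N - Suc t) * (bops b + 1 + K) + bops b + 1" "I N \<tau>"
      unfolding runs_def by blast
    have "bops b + 1 + k + l \<le> (N - t) * (bops b + 1 + K) + bops b + 1"
      using 1(3) 2(2) \<open>t < N\<close> by (simp add: Suc_diff_Suc[symmetric])
    with exec.WhileTrue[OF 1(1,2) 2(1)] 2(3) show ?case
      unfolding runs_def by blast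
  qed
  from this[of 0 \<sigma>] init show ?thesis by simp
qed


section \<open>The algorithm\<close>

text \<open>Adds \<open>local_sum adj v\<close> to \<open>S\<close>; the conditional selects the
  larger of the degrees of \<open>v\<close> and its neighbor \<open>u\<close>.\<close>

definition scan :: com where
  "scan = While (Less (Reg ''j'') (Reg ''d''))
     (Seq (Neighbor ''u'' (Reg ''v'') (Reg ''j''))
     (Seq (Degree ''c'' (Reg ''u''))
     (Seq (Cond (Less (Reg ''c'') (Reg ''d''))
             (Assign ''S'' (Plus (Reg ''S'') (Log2 (Reg ''d''))))
             (Assign ''S'' (Plus (Reg ''S'') (Log2 (Reg ''c'')))))
       (Assign ''j'' (Plus (Reg ''j'') (Lit 1))))))"

text \<open>\<open>B\<close> need not be an integer: counting \<open>i\<close> up while it is below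
  \<open>B\<close> stops at the ceiling, so no rounding operation is required.\<close>

definition sampling_loop :: com where
  "sampling_loop = While (Less (Reg ''i'') (Reg ''B''))
     (Seq (Sample ''v'')
     (Seq (Degree ''d'' (Reg ''v''))
     (Seq (Assign ''j'' (Lit 0))
     (Seq scan
       (Assign ''i'' (Plus (Reg ''i'') (Lit 1)))))))"

text \<open>
  For \<open>\<epsilon> \<ge> log \<Delta>\<close> the time bound may be too small to scan even one vertex; then
  \<open>log (2 m)\<close> is itself accurate enough, as the mean weight lies between \<open>0\<close> and \<open>log \<Delta>\<close>. The
  sampling loop relies on all registers other than the inputs being initially \<open>0\<close>.
\<close>

definition algorithm :: "nat \<Rightarrow> com" where
  "algorithm M =
     Seq (Assign ''H'' (Log2 (Times (Lit 2) (Reg ''m''))))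
     (Cond (Less (Reg ''eps'') (Log2 (Reg ''Delta'')))
       (Seq (Assign ''R'' (Divide (Times (Reg ''Delta'') (Log2 (Reg ''Delta''))) (Reg ''eps'')))
       (Seq (Assign ''B'' (Times (Lit M) (Times (Reg ''R'') (Reg ''R''))))
       (Seq sampling_loop
         (Assign ''H'' (Plus (Minus (Reg ''H'')
            (Times (Divide (Reg ''n'') (Times (Lit 2) (Reg ''m''))) (Divide (Reg ''S'') (Reg ''i''))))
            (Divide (Reg ''eps'') (Lit 2)))))))
       Skip)"

text \<open>The quotient is the range \<Delta> log \<Delta> / 2 of a scaled sample divided by the
  deviation \<epsilon> / 2, so Hoeffding's exponent is at most - 2 M.\<close>

definition sample_size :: "nat \<Rightarrow> nat \<Rightarrow> real \<Rightarrow> nat" where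
  "sample_size M \<Delta> \<epsilon> = nat \<lceil>real M * (real \<Delta> * log 2 (real \<Delta>) / \<epsilon>)\<^sup>2\<rceil>"

text \<open>Adding \<epsilon> / 2 turns a two-sided error of \<epsilon> / 2 into an excess between 0
  and \<epsilon>, so that OPT stays a lower bound.\<close>

definition estimate ::
  "nat \<Rightarrow> (nat \<Rightarrow> nat list) \<Rightarrow> nat \<Rightarrow> nat \<Rightarrow> nat \<Rightarrow> real \<Rightarrow> (nat \<Rightarrow> nat) \<Rightarrow> real" where
  "estimate M adj n m \<Delta> \<epsilon> \<omega> =
     (if \<epsilon> < log 2 (real \<Delta>)
      then log 2 (2 * real m) - real n / (2 * real m) *
        ((\<Sum>t<sample_size M \<Delta> \<epsilon>. local_sum adj (\<omega> t)) / real (sample_size M \<Delta> \<epsilon>)) + \<epsilon> / 2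
      else log 2 (2 * real m))"

text \<open>A neighbor costs 11: guard and branch 2, the two queries 2, the conditional 5, the
  increment 2. The failing guard adds 2. The frame condition protects the registers of the outer
  loop.\<close>

lemma runs_scan:
  assumes "s ''v'' = real v" "s ''d'' = real (length (adj v))" "s ''j'' = 0"
  shows "runs adj \<omega> scan (s, i) (length (adj v) * 11 + 2)
    (\<lambda>(s', i'). i' = i \<and> s' ''S'' = s ''S'' + local_sum adj v \<and>
       (\<forall>r. r \<notin> {''j'', ''u'', ''c'', ''S''} \<longrightarrow> s' r = s r))"
proof -
  define w where "w t = log 2 (real (max (length (adj v)) (length (adj (adj v ! t)))))" for t
  define I where "I t = (\<lambda>(s', i'). i' = i \<and> s' ''j'' = real t \<and>
      s' ''S'' = s ''S'' + (\<Sum>l<t. w l) \<and>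
      (\<forall>r. r \<notin> {''j'', ''u'', ''c'', ''S''} \<longrightarrow> s' r = s r))" for t :: nat
  let ?c = "Seq (Neighbor ''u'' (Reg ''v'') (Reg ''j''))
     (Seq (Degree ''c'' (Reg ''u''))
     (Seq (Cond (Less (Reg ''c'') (Reg ''d''))
             (Assign ''S'' (Plus (Reg ''S'') (Log2 (Reg ''d''))))
             (Assign ''S'' (Plus (Reg ''S'') (Log2 (Reg ''c'')))))
       (Assign ''j'' (Plus (Reg ''j'') (Lit 1)))))"
  have "runs adj \<omega> (While (Less (Reg ''j'') (Reg ''d'')) ?c) (s, i)
     (length (adj v) * (bops (Less (Reg ''j'') (Reg ''d'')) + 1 + 9) +
        bops (Less (Reg ''j'') (Reg ''d'')) + 1) (I (length (adj v)))"
  proof (rule runs_While)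
    fix t \<sigma> assume t: "t < length (adj v)" and I: "I t \<sigma>"
    obtain s' where \<sigma>: "\<sigma> = (s', i)"
      using I by (cases \<sigma>) (auto simp: I_def)
    have s': "s' ''j'' = real t" "s' ''S'' = s ''S'' + (\<Sum>l<t. w l)"
      "s' ''v'' = real v" "s' ''d'' = real (length (adj v))"
      and frame: "\<And>r. r \<notin> {''j'', ''u'', ''c'', ''S''} \<Longrightarrow> s' r = s r"
      using I assms by (auto simp: I_def \<sigma>)
    have "runs adj \<omega> ?c \<sigma> 9 (I (Suc t))"
      unfolding \<sigma>
      by (rule runs_le, rule runs_Seq, rule runs_Neighbor[where v = v and j = t],
          simp add: s', simp add: s', rule t, rule runs_Seq,
          rule runs_Degree[where v = "adj v ! t"], simp, rule runs_Seq,
          rule runs_Cond; (rule runs_Assign)?, (rule runs_Assign)?)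
        (use s' frame in \<open>simp_all add: I_def w_def max_def\<close>)
    then show "bval (Less (Reg ''j'') (Reg ''d'')) (fst \<sigma>) \<and> runs adj \<omega> ?c \<sigma> 9 (I (Suc t))"
      using t s' by (simp add: \<sigma>)
  next
    fix \<sigma> assume I: "I (length (adj v)) \<sigma>"
    obtain s' where \<sigma>: "\<sigma> = (s', i)"
      using I by (cases \<sigma>) (auto simp: I_def)
    have "s' ''j'' = real (length (adj v))" "s' ''d'' = s ''d''"
      using I by (simp_all add: I_def \<sigma>)
    then show "\<not> bval (Less (Reg ''j'') (Reg ''d'')) (fst \<sigma>)"
      using assms(2) by (simp add: \<sigma>)
  next
    show "I 0 (s, i)"
      using assms(3) by (simp add: I_def)
  qed
  moreover have "(\<Sum>l<length (adj v). w l) = local_sum adj v"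
    by (simp add: w_def local_sum_def sum_list_sum_nth atLeast0LessThan)
  ultimately show ?thesis
    unfolding scan_def by (elim runs_mono) (auto simp: I_def)
qed

text \<open>The invariant ties the sample counter to the iteration, so iteration \<open>t\<close>
  reads \<open>\<omega> t\<close>. An iteration costs at most \<open>11 * D + 2\<close> for the
  scan, 5 for the other commands and 2 for the guard.\<close>

lemma runs_sampling_loop:
  assumes s: "s ''i'' = 0" "s ''S'' = 0" "s ''B'' = b"
    and deg: "\<And>t. length (adj (\<omega> t)) \<le> D"
  shows "runs adj \<omega> sampling_loop (s, 0) (nat \<lceil>b\<rceil> * (11 * D + 9) + 2)
    (\<lambda>(s', _). s' ''i'' = real (nat \<lceil>b\<rceil>) \<and> s' ''S'' = (\<Sum>t<nat \<lceil>b\<rceil>. local_sum adj (\<omega> t)) \<and>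
       (\<forall>r\<in>{''H'', ''n'', ''m'', ''eps''}. s' r = s r))"
proof -
  define I where "I t = (\<lambda>(s', k). k = t \<and> s' ''i'' = real t \<and> s' ''B'' = b \<and>
      s' ''S'' = (\<Sum>l<t. local_sum adj (\<omega> l)) \<and>
      (\<forall>r\<in>{''H'', ''n'', ''m'', ''eps''}. s' r = s r))" for t :: nat
  let ?c = "Seq (Sample ''v'')
     (Seq (Degree ''d'' (Reg ''v''))
     (Seq (Assign ''j'' (Lit 0))
     (Seq scan
       (Assign ''i'' (Plus (Reg ''i'') (Lit 1))))))"
  have "runs adj \<omega> (While (Less (Reg ''i'') (Reg ''B'')) ?c) (s, 0)
     (nat \<lceil>b\<rceil> * (bops (Less (Reg ''i'') (Reg ''B'')) + 1 + (11 * D + 7)) +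
        bops (Less (Reg ''i'') (Reg ''B'')) + 1) (I (nat \<lceil>b\<rceil>))"
  proof (rule runs_While)
    fix t \<sigma> assume t: "t < nat \<lceil>b\<rceil>" and I: "I t \<sigma>"
    obtain s' where \<sigma>: "\<sigma> = (s', t)"
      using I by (cases \<sigma>) (auto simp: I_def)
    have s': "s' ''i'' = real t" "s' ''S'' = (\<Sum>l<t. local_sum adj (\<omega> l))" "s' ''B'' = b"
      and frame: "\<And>r. r \<in> {''H'', ''n'', ''m'', ''eps''} \<Longrightarrow> s' r = s r"
      using I by (auto simp: I_def \<sigma>)
    \<comment> \<open>An integer below the ceiling of \<open>b\<close> is below \<open>b\<close>
      itself.\<close>
    have tb: "real t < b"
      using t by linarith
    let ?v = "\<omega> t"
    let ?s = "s'(''v'' := real ?v, ''d'' := real (length (adj ?v)), ''j'' := 0)"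
    have "runs adj \<omega> scan (?s, Suc t) (D * 11 + 2)
        (\<lambda>\<tau>. runs adj \<omega> (Assign ''i'' (Plus (Reg ''i'') (Lit 1))) \<tau> 2 (I (Suc t)))"
    proof (rule runs_mono[OF runs_scan[where v = ?v]])
      fix \<tau> assume "case \<tau> of (s'', i') \<Rightarrow> i' = Suc t \<and> s'' ''S'' = ?s ''S'' + local_sum adj ?v \<and>
         (\<forall>r. r \<notin> {''j'', ''u'', ''c'', ''S''} \<longrightarrow> s'' r = ?s r)"
      then obtain s'' where \<tau>: "\<tau> = (s'', Suc t)" "s'' ''S'' = ?s ''S'' + local_sum adj ?v"
          "\<And>r. r \<notin> {''j'', ''u'', ''c'', ''S''} \<Longrightarrow> s'' r = ?s r"
        by (cases \<tau>) auto
      show "runs adj \<omega> (Assign ''i'' (Plus (Reg ''i'') (Lit 1))) \<tau> 2 (I (Suc t))"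
        unfolding \<tau>(1)
        by (rule runs_le, rule runs_Assign) (use \<tau>(2,3) s' frame in \<open>auto simp: I_def\<close>)
    qed (use deg[of t] in auto)
    then have "runs adj \<omega> ?c \<sigma> (11 * D + 7) (I (Suc t))"
      unfolding \<sigma>
      by - (rule runs_le, rule runs_Seq, rule runs_Sample, rule runs_Seq,
          rule runs_Degree[where v = ?v], simp, rule runs_Seq, rule runs_Assign, rule runs_Seq, auto)
    then show "bval (Less (Reg ''i'') (Reg ''B'')) (fst \<sigma>) \<and> runs adj \<omega> ?c \<sigma> (11 * D + 7) (I (Suc t))"
      using tb s' by (simp add: \<sigma>)
  next
    show "\<not> bval (Less (Reg ''i'') (Reg ''B'')) (fst \<sigma>)" if "I (nat \<lceil>b\<rceil>) \<sigma>" for \<sigma>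
      using that by (auto simp: I_def not_less) linarith
  qed (use s in \<open>auto simp: I_def\<close>)
  then show ?thesis
    unfolding sampling_loop_def by (rule runs_mono) (auto simp: I_def algebra_simps)
qed

text \<open>The constant 30 is a rounded allowance for all that happens outside the loop iterations,
  including the failing guard of the loop.\<close>

lemma returns_estimate:
  assumes deg: "\<And>t. length (adj (\<omega> t)) \<le> \<Delta>"
  shows "\<exists>k. returns adj \<omega> (algorithm M) n m \<Delta> \<epsilon> k (estimate M adj n m \<Delta> \<epsilon> \<omega>) \<and>
    k \<le> 30 + (if \<epsilon> < log 2 (real \<Delta>) then sample_size M \<Delta> \<epsilon> * (11 * \<Delta> + 9) else 0)"
proof -
  let ?R = "real \<Delta> * log 2 (real \<Delta>) / \<epsilon>"
  let ?b = "real M * (?R * ?R)"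
  let ?K = "if \<epsilon> < log 2 (real \<Delta>) then sample_size M \<Delta> \<epsilon> * (11 * \<Delta> + 9) else 0"
  let ?Q = "\<lambda>(t :: store, i :: nat). t ''H'' = estimate M adj n m \<Delta> \<epsilon> \<omega>"
  let ?s = "init_store n m \<Delta> \<epsilon>"
  let ?s1 = "?s(''H'' := log 2 (2 * real m))"
  let ?s2 = "?s1(''R'' := ?R, ''B'' := ?b)"
  let ?N = "sample_size M \<Delta> \<epsilon>"
  let ?result = "Plus (Minus (Reg ''H'')
    (Times (Divide (Reg ''n'') (Times (Lit 2) (Reg ''m''))) (Divide (Reg ''S'') (Reg ''i''))))
    (Divide (Reg ''eps'') (Lit 2))"
  let ?sampling = "Seq (Assign ''R'' (Divide (Times (Reg ''Delta'') (Log2 (Reg ''Delta''))) (Reg ''eps'')))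
       (Seq (Assign ''B'' (Times (Lit M) (Times (Reg ''R'') (Reg ''R''))))
       (Seq sampling_loop (Assign ''H'' ?result)))"
  have N: "?N = nat \<lceil>?b\<rceil>"
    by (simp add: sample_size_def power2_eq_square)
  have "runs adj \<omega> ?sampling (?s1, 0) (18 + ?K) ?Q" if less: "\<epsilon> < log 2 (real \<Delta>)"
  proof -
    have loop: "runs adj \<omega> sampling_loop (?s2, 0) (?N * (11 * \<Delta> + 9) + 2)
        (\<lambda>(s, _). s ''i'' = real ?N \<and> s ''S'' = (\<Sum>t<?N. local_sum adj (\<omega> t)) \<and>
          (\<forall>r\<in>{''H'', ''n'', ''m'', ''eps''}. s r = ?s2 r))"
      unfolding N by (rule runs_sampling_loop) (use deg in \<open>simp_all add: init_store_def\<close>)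
    have "runs adj \<omega> sampling_loop (?s2, 0) (?N * (11 * \<Delta> + 9) + 2)
        (\<lambda>\<tau>. runs adj \<omega> (Assign ''H'' ?result) \<tau> 8 ?Q)"
    proof (rule runs_mono[OF loop], safe)
      fix s i
      assume "s ''i'' = real ?N" "s ''S'' = (\<Sum>t<?N. local_sum adj (\<omega> t))"
        "\<forall>r\<in>{''H'', ''n'', ''m'', ''eps''}. s r = ?s2 r"
      then have "aval ?result s = estimate M adj n m \<Delta> \<epsilon> \<omega>"
        using less by (simp add: estimate_def init_store_def)
      then show "runs adj \<omega> (Assign ''H'' ?result) (s, i) 8 ?Q"
        by (intro runs_mono[OF runs_Assign[where Q = ?Q]]) simp_all
    qed
    then show ?thesis
      by - (rule runs_le, rule runs_Seq, rule runs_Assign, rule runs_Seq, rule runs_Assign,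
          rule runs_Seq, auto simp: init_store_def N less)
  qed
  moreover have "runs adj \<omega> Skip (?s1, 0) 1 ?Q" if "\<not> \<epsilon> < log 2 (real \<Delta>)"
    by (rule runs_Skip) (use that in \<open>simp add: estimate_def\<close>)
  ultimately have "runs adj \<omega> (algorithm M) (?s, 0) (30 + ?K) ?Q"
    unfolding algorithm_def
    by - (rule runs_le, rule runs_Seq, rule runs_Assign, rule runs_Cond[where K = "18 + ?K" and L = 1],
        auto simp: init_store_def)
  then show ?thesis
    unfolding runs_def returns_def by fastforce
qed


text \<open>As \<epsilon> < log \<Delta>, the quotient \<open>R\<close> is at least 1, and
  \<open>R\<^sup>2\<close> absorbs the 1 lost to the ceiling. The scanning cost, linear in \<Delta>,
  is bounded by a quadratic to reach the fourth power.\<close>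

lemma cost_bound:
  fixes \<epsilon> :: real
  assumes \<Delta>: "\<Delta> \<ge> 2" and \<epsilon>: "0 < \<epsilon>" "\<epsilon> < log 2 (real \<Delta>)"
  shows "real (sample_size M \<Delta> \<epsilon> * (11 * \<Delta> + 9))
    \<le> 20 * (real M + 1) * (real \<Delta> ^ 4 * (log 2 (real \<Delta>))\<^sup>2 / \<epsilon>\<^sup>2)"
proof -
  define R where "R = real \<Delta> * log 2 (real \<Delta>) / \<epsilon>"
  have "1 * 1 \<le> real \<Delta> * (log 2 (real \<Delta>) / \<epsilon>)"
    using \<Delta> \<epsilon> by (intro mult_mono) auto
  then have "1 \<le> R\<^sup>2"
    by (simp add: R_def one_le_power)
  moreover have "real (sample_size M \<Delta> \<epsilon>) \<le> real M * R\<^sup>2 + 1"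
    unfolding sample_size_def R_def[symmetric] using zero_le_power2[of R]
    by (simp add: of_nat_nat)
  ultimately have "real (sample_size M \<Delta> \<epsilon>) \<le> (real M + 1) * R\<^sup>2"
    by (simp add: algebra_simps)
  moreover have "real (11 * \<Delta> + 9) \<le> 20 * (real \<Delta>)\<^sup>2"
  proof -
    have "real \<Delta> \<ge> 2"
      using \<Delta> by simp
    moreover from this have "2 * real \<Delta> \<le> (real \<Delta>)\<^sup>2"
      unfolding power2_eq_square by (intro mult_right_mono) auto
    ultimately show ?thesis
      unfolding of_nat_add of_nat_mult of_nat_numeral by linarith
  qed
  ultimately have "real (sample_size M \<Delta> \<epsilon>) * real (11 * \<Delta> + 9)
      \<le> ((real M + 1) * R\<^sup>2) * (20 * (real \<Delta>)\<^sup>2)"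
    by (intro mult_mono) auto
  also have "\<dots> = 20 * (real M + 1) * (real \<Delta> ^ 4 * (log 2 (real \<Delta>))\<^sup>2 / \<epsilon>\<^sup>2)"
    by (simp add: R_def power_mult_distrib power_divide power2_eq_square power4_eq_xxxx)
  finally show ?thesis
    by simp
qed

section \<open>Accuracy and worst-case time on a graph\<close>

context local_access_graph
begin

text \<open>By OPT \<le> Z \<le> OPT + 1 it suffices that the estimate lies between Z and Z +
  \<epsilon>. This is certain for \<epsilon> \<ge> log \<Delta> and follows from Hoeffding's
  inequality otherwise.\<close>

lemma estimate_accurate:
  assumes V: "card V \<le> card E" and \<epsilon>: "\<epsilon> > 0" and M: "M > 0"
  defines "\<Delta> \<equiv> max_degree V E"
  defines "est \<equiv> estimate M adj (card V) (card E) \<Delta> \<epsilon>"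
  shows "\<P>(\<omega> in samples V. OPT V E \<le> est \<omega> \<and> est \<omega> \<le> OPT V E + (1 + \<epsilon>)) \<ge> 1 - 1 / real M"
proof -
  have "V \<noteq> {}"
    using edges_nonempty edge_subset edge_not_empty by blast
  then interpret prob_space "samples V"
    by (intro prob_space_samples finite_vertices)
  let ?Z = "log 2 (2 * real (card E)) - mean_weight"
  have est_meas [measurable]: "est \<in> borel_measurable (samples V)"
    unfolding est_def estimate_def by measurable
  have ok: "OPT V E \<le> est \<omega> \<and> est \<omega> \<le> OPT V E + (1 + \<epsilon>)"
    if "?Z \<le> est \<omega>" "est \<omega> \<le> ?Z + \<epsilon>" for \<omega>
    using OPT_le OPT_ge that by auto
  show ?thesis
  proof (cases "\<epsilon> < log 2 (real \<Delta>)")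
    case False
    then have "OPT V E \<le> est \<omega> \<and> est \<omega> \<le> OPT V E + (1 + \<epsilon>)" for \<omega>
      using mean_weight_nonneg mean_weight_le by (intro ok) (auto simp: est_def estimate_def \<Delta>_def)
    then show ?thesis
      using M by (simp add: prob_space)
  next
    case True
    define N where "N = sample_size M \<Delta> \<epsilon>"
    \<comment> \<open>Scaling each sample by \<open>c\<close> makes the expectation equal to the
      mean weight; m \<ge> n gives \<open>c \<le> 1 / 2\<close>, hence the range bound
      \<open>b\<close>.\<close>
    define c where "c = real (card V) / (2 * real (card E))"
    define b where "b = real \<Delta> * log 2 (real \<Delta>) / 2"
    define err where "err \<omega> = \<bar>(\<Sum>t<N. c * local_sum adj (\<omega> t)) / real N -
      (\<Sum>v\<in>V. c * local_sum adj v) / real (card V)\<bar>" for \<omega>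
    have \<Delta>: "\<Delta> \<ge> 2"
      unfolding \<Delta>_def by (rule max_degree_ge_2[OF V])
    have cardV: "card V > 0"
      using \<open>V \<noteq> {}\<close> finite_vertices by (simp add: card_gt_0_iff)
    have b: "b > 0"
      using \<Delta> \<epsilon> True by (simp add: b_def)
    have c: "0 \<le> c" "c \<le> 1 / 2"
      using V card_edges_pos by (auto simp: c_def field_simps)
    have B: "real M * (2 * b / \<epsilon>)\<^sup>2 \<le> real N"
      unfolding N_def sample_size_def b_def by (simp add: of_nat_ceiling)
    moreover have "0 < real M * (2 * b / \<epsilon>)\<^sup>2"
      using M b \<epsilon> by simp
    ultimately have N: "N > 0"
      by (simp only: of_nat_0_less_iff[where 'a = real, symmetric])
    have mean: "(\<Sum>v\<in>V. c * local_sum adj v) / real (card V) = mean_weight"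
      using cardV card_edges_pos unfolding sum_distrib_left[symmetric] by (simp add: sum_local_sum c_def)
    have "\<P>(\<omega> in samples V. err \<omega> \<ge> \<epsilon> / 2) \<le> 2 * exp (- 2 * real N * (\<epsilon> / 2)\<^sup>2 / b\<^sup>2)"
      unfolding err_def
    proof (rule sampling_error[OF finite_vertices \<open>V \<noteq> {}\<close> _ _ b N])
      fix v assume v: "v \<in> V"
      show "0 \<le> c * local_sum adj v"
        using c local_sum_bounds[OF v] by simp
      have "c * local_sum adj v \<le> 1 / 2 * (real \<Delta> * log 2 (real \<Delta>))"
        unfolding \<Delta>_def using c local_sum_bounds[OF v] by (intro mult_mono) auto
      then show "c * local_sum adj v \<le> b"
        by (simp add: b_def)
    qed (use \<epsilon> in simp)
    also have "\<dots> \<le> 2 * exp (- (2 * real M))"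
    proof -
      have "2 * real M \<le> 2 * real N * (\<epsilon> / 2)\<^sup>2 / b\<^sup>2"
        using B b \<epsilon> by (simp add: field_simps power2_eq_square)
      then show ?thesis
        by simp
    qed
    also have "\<dots> \<le> 1 / real M"
    proof -
      have "2 * real M \<le> exp (2 * real M)"
        using exp_ge_add_one_self[of "2 * real M"] by linarith
      then show ?thesis
        using M by (simp add: exp_minus field_simps)
    qed
    finally have "1 - 1 / real M \<le> 1 - \<P>(\<omega> in samples V. err \<omega> \<ge> \<epsilon> / 2)"
      by simp
    also have "\<dots> = \<P>(\<omega> in samples V. \<not> err \<omega> \<ge> \<epsilon> / 2)"
      by (rule prob_neg[symmetric]) (unfold err_def, measurable)
    also have "\<dots> \<le> \<P>(\<omega> in samples V. OPT V E \<le> est \<omega> \<and> est \<omega> \<le> OPT V E + (1 + \<epsilon>))"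
    proof (intro finite_measure_mono subsetI)
      fix \<omega> assume "\<omega> \<in> {\<omega> \<in> space (samples V). \<not> err \<omega> \<ge> \<epsilon> / 2}"
      then have \<omega>: "\<omega> \<in> space (samples V)" "err \<omega> < \<epsilon> / 2"
        by auto
      have "est \<omega> = log 2 (2 * real (card E)) - (\<Sum>t<N. c * local_sum adj (\<omega> t)) / real N + \<epsilon> / 2"
        using True unfolding sum_distrib_left[symmetric] by (simp add: est_def estimate_def N_def c_def)
      then have "?Z \<le> est \<omega>" "est \<omega> \<le> ?Z + \<epsilon>"
        using \<omega>(2) unfolding err_def mean by linarith+
      then show "\<omega> \<in> {\<omega> \<in> space (samples V). OPT V E \<le> est \<omega> \<and> est \<omega> \<le> OPT V E + (1 + \<epsilon>)}"
        using \<omega>(1) ok by simp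
    qed measurable
    finally show ?thesis .
  qed
qed

lemma sample_in_vertices: "\<omega> \<in> space (samples V) \<Longrightarrow> \<omega> t \<in> V"
  by (auto simp: samples_def space_PiM space_uniform_count_measure)

text \<open>All sampled vertices lie in \<open>V\<close> for every sequence in the space, not just
  almost every one, so the time bound is a worst-case bound.\<close>

lemma returns_estimate_on_samples:
  assumes "\<omega> \<in> space (samples V)"
  shows "\<exists>k. returns adj \<omega> (algorithm M) n m (max_degree V E) \<epsilon> k
      (estimate M adj n m (max_degree V E) \<epsilon> \<omega>) \<and>
    k \<le> 30 + (if \<epsilon> < log 2 (real (max_degree V E))
      then sample_size M (max_degree V E) \<epsilon> * (11 * max_degree V E + 9) else 0)"
  by (rule returns_estimate)
    (simp add: length_adj vdegree_le_max_degree sample_in_vertices[OF assms])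

end

lemma returns_unique: "returns adj \<omega> P n m \<Delta> \<epsilon> k H \<Longrightarrow> returns adj \<omega> P n m \<Delta> \<epsilon> k' H' \<Longrightarrow> H' = H"
  unfolding returns_def using exec_deterministic by (metis prod.inject)

text \<open>High probability means \<open>1 - \<delta>\<close> for any prescribed
  \<open>\<delta>\<close>; program and constant depend on \<open>\<delta>\<close> alone, through the
  choice of \<open>M\<close> above \<open>1 / \<delta>\<close>. The \<open>max 1\<close> pays for
  the constant overhead when \<epsilon> is so large that the bound drops below 1.\<close>

theorem theorem3:
  fixes \<delta> :: real
  assumes "\<delta> > 0"
  shows "\<exists>(P :: com) (C :: real).
    \<forall>V E adj (n :: nat) (m :: nat) (\<Delta> :: nat) (\<epsilon> :: real).
      simple_graph V E \<longrightarrow> V \<noteq> {} \<longrightarrow> adjacency_lists V E adj \<longrightarrow>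
      n = card V \<longrightarrow> m = card E \<longrightarrow> m \<ge> n \<longrightarrow> \<Delta> = max_degree V E \<longrightarrow> \<epsilon> > 0 \<longrightarrow>
        (\<forall>\<omega> \<in> space (samples V). \<exists>k H. returns adj \<omega> P n m \<Delta> \<epsilon> k H \<and>
           real k \<le> C * max 1 (real \<Delta> ^ 4 * (log 2 (real \<Delta>))\<^sup>2 / \<epsilon>\<^sup>2)) \<and>
        \<P>(\<omega> in samples V. \<exists>k H. returns adj \<omega> P n m \<Delta> \<epsilon> k H \<and>
           OPT V E \<le> H \<and> H \<le> OPT V E + (1 + \<epsilon>)) \<ge> 1 - \<delta>"
proof -
  obtain M :: nat where "1 / \<delta> < real M"
    using reals_Archimedean2 by blast
  moreover from this have "M > 0"
    using assms by (auto intro: gr0I)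
  ultimately have M: "M > 0" "1 / real M \<le> \<delta>"
    using assms by (simp_all add: field_simps)
  show ?thesis
  proof (intro exI[of _ "algorithm M"] exI[of _ "30 + 20 * (real M + 1)"] allI impI conjI ballI)
    fix V E adj and n m \<Delta> :: nat and \<epsilon> :: real
    assume asm: "simple_graph V E" "V \<noteq> {}" "adjacency_lists V E adj" "n = card V" "m = card E"
      "m \<ge> n" "\<Delta> = max_degree V E" "\<epsilon> > 0"
    \<comment> \<open>Without edges, m \<ge> n would force \<open>V\<close> to be empty.\<close>
    then have "E \<noteq> {}"
      by (auto simp: simple_graph_def)
    with asm interpret local_access_graph V E adj
      by unfold_locales
    note run = returns_estimate_on_samples[of _ M n m \<epsilon>, folded \<open>\<Delta> = max_degree V E\<close>]
    let ?T = "real \<Delta> ^ 4 * (log 2 (real \<Delta>))\<^sup>2 / \<epsilon>\<^sup>2"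
    have cost: "real (30 + (if \<epsilon> < log 2 (real \<Delta>) then sample_size M \<Delta> \<epsilon> * (11 * \<Delta> + 9) else 0))
        \<le> (30 + 20 * (real M + 1)) * max 1 ?T"
    proof (cases "\<epsilon> < log 2 (real \<Delta>)")
      case True
      have "\<Delta> \<ge> 2"
        using max_degree_ge_2 asm by simp
      then have "real (sample_size M \<Delta> \<epsilon> * (11 * \<Delta> + 9)) \<le> 20 * (real M + 1) * ?T"
        using asm(8) True by (rule cost_bound)
      also have "\<dots> \<le> 20 * (real M + 1) * max 1 ?T"
        by (intro mult_left_mono) auto
      finally show ?thesis
        using True max.cobounded1[of 1 ?T] by (simp add: distrib_right)
    next
      case False
      have "30 * 1 \<le> (30 + 20 * (real M + 1)) * max 1 ?T"
        by (intro mult_mono) auto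
      then show ?thesis
        using False by simp
    qed
    show "\<exists>k H. returns adj \<omega> (algorithm M) n m \<Delta> \<epsilon> k H \<and>
           real k \<le> (30 + 20 * (real M + 1)) * max 1 ?T"
      if "\<omega> \<in> space (samples V)" for \<omega>
      using run[OF that] cost by (meson of_nat_le_iff order_trans)
    \<comment> \<open>By determinism the only possible output is the estimate, so this is the event
      already bounded.\<close>
    have "{\<omega> \<in> space (samples V). \<exists>k H. returns adj \<omega> (algorithm M) n m \<Delta> \<epsilon> k H \<and>
           OPT V E \<le> H \<and> H \<le> OPT V E + (1 + \<epsilon>)} =
        {\<omega> \<in> space (samples V). OPT V E \<le> estimate M adj n m \<Delta> \<epsilon> \<omega> \<and>
           estimate M adj n m \<Delta> \<epsilon> \<omega> \<le> OPT V E + (1 + \<epsilon>)}"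
      using run returns_unique by (intro Collect_cong conj_cong refl) metis
    then show "1 - \<delta> \<le> \<P>(\<omega> in samples V. \<exists>k H. returns adj \<omega> (algorithm M) n m \<Delta> \<epsilon> k H \<and>
           OPT V E \<le> H \<and> H \<le> OPT V E + (1 + \<epsilon>))"
      using estimate_accurate[of \<epsilon> M] asm M by simp
  qed
qed

end
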